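(* Let $(x_k)$ be generated by the inexact proximal-gradient iteration $x_{k+1}=\operatorname{prox}_{1/L}\{x_k-\tfrac1L(\nabla f(x_k)+e_k)\}$ described in the context. Suppose that for each $\beta\in(0,1)$, $$U_k\le\lambda\beta^k$$ for some constant $\lambda>0$ and for all $k$, and that the errors satisfy the exponential tail condition $$\Pr\big([e_k]_i\ge\epsilon\mid\mathcal F_{k-1}\big)\le\exp(-\epsilon^2/U_k)$$ for each component $i$. Then $$\Pr(\pi_k-\rho^k\pi_0\ge\epsilon)=O\left(\exp\left[-\frac{\epsilon}{\max\{\beta,\rho\}^k}\cdot\zeta\right]\right)\quad\text{for some }\zeta>0.$$
   Context: Setting. $f:\mathbb R^n\to\mathbb R$ is differentiable, $g:\mathbb R^n\to(-\infty,+\infty]$ is convex and lower semicontinuous, $h:=f+g$, and the solution set $\mathcal S:=\arg\min h$ is nonempty. $\|\cdot\|$ is the Euclidean norm. For $\alpha>0$, $\operatorname{prox}_\alpha\{z\}:=\arg\min_y\{\alpha g(y)+\tfrac12\|z-y\|^2\}$. There are constants $L>0$ and $\tau\ge 1$ such that for all $x,y\in\mathbb R^n$: $\|\nabla f(y)-\nabla f(x)\|\le L\|y-x\|$, and $\min_{\bar x\in\mathcal S}\|x-\bar x\|\le\tau\,\|x-\operatorname{prox}_{1/L}\{x-\tfrac1L\nabla f(x)\}\|$. The errors $e_k$ ($k\ge 0$) are random vectors in $\mathbb R^n$; $[e_k]_i$ is the $i$th component of $e_k$. The $U_k$ are real numbers bounding the size of the errors. The optimality gap is $\pi_k:=h(x_k)-\inf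 h$. $\mathcal F_k$ is the $\sigma$-algebra generated by $e_0,\dots,e_k$ (and $\mathcal F_{-1}$ is trivial). Constant: $\rho:=\frac{40\tau^2}{1+40\tau^2}$.
   Formalization: The exponential tail condition is assumed for both [e_k]_i and −[e_k]_i (for ε>0), since the printed one-sided condition lets e_k have heavy negative tails and the claim fails; also U_k>0 and a deterministic x_0 with g(x_0) finite are assumed so that the expressions make sense. *)

theory Defs
  imports "HOL-Probability.Probability" "HOL-Library.Landau_Symbols"
begin

(* Extended-real-valued convexity; convex_on only covers real-valued functions.
   In ereal, 0 * \<infinity> = 0, so the endpoints t = 0 and t = 1 impose nothing. *)
definition ereal_convex :: "('a::real_vector \<Rightarrow> ereal) \<Rightarrow> bool" where
  "ereal_convex g \<longleftrightarrow>
     (\<forall>x y. \<forall>t\<in>{0..1::real}. g ((1 - t) *\<^sub>R x + t *\<^sub>R y) \<le> ereal (1 - t) * g x + ereal t * g y)"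

definition lower_semicont :: "('a::topological_space \<Rightarrow> ereal) \<Rightarrow> bool" where
  "lower_semicont g \<longleftrightarrow> (\<forall>x. g x \<le> Liminf (at x) g)"

definition argmin_set :: "('a \<Rightarrow> ereal) \<Rightarrow> 'a set" where
  "argmin_set F = {x. is_arg_min F (\<lambda>_. True) x}"

(* arg_min selects some minimizer. For g convex, lower semicontinuous, > -\<infinity> and not
   identically \<infinity>, and \<alpha> > 0, the minimizer exists and is unique. *)
definition prox :: "('a::real_normed_vector \<Rightarrow> ereal) \<Rightarrow> real \<Rightarrow> 'a \<Rightarrow> 'a" where
  "prox g \<alpha> z = arg_min (\<lambda>y. ereal \<alpha> * g y + ereal (1 / 2 * (norm (z - y))\<^sup>2)) (\<lambda>_. True)"

(* The sigma-algebra generated by e 0, ..., e (k - 1), i.e. F_{k-1}; trivial for k = 0. *)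
definition past_algebra :: "'w measure \<Rightarrow> (nat \<Rightarrow> 'w \<Rightarrow> 'b::topological_space) \<Rightarrow> nat \<Rightarrow> 'w measure" where
  "past_algebra M e k = sigma (space M) (\<Union>j<k. {e j -` A \<inter> space M | A. A \<in> sets borel})"

(* Conditional probability of an event given a sub-sigma-algebra, as a random variable. *)
definition cond_pr :: "'w measure \<Rightarrow> 'w measure \<Rightarrow> ('w \<Rightarrow> bool) \<Rightarrow> 'w \<Rightarrow> real" where
  "cond_pr M F P = real_cond_exp M F (indicator {\<omega> \<in> space M. P \<omega>})"

end

theory Submission
  imports Defs
begin

text \<open>
  Convexity of \<open>f\<close> is not available, but the quadratic bounds on \<open>f\<close>, the variational inequality of
  the proximal step and the error bound give, for \<open>\<kappa> = 8 \<tau>\<^sup>2\<close>, the recursion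
  \<open>(1 + \<kappa>) \<pi>\<^sub>k\<^sub>+\<^sub>1 \<le> \<kappa> \<pi>\<^sub>k + C \<parallel>e\<^sub>k\<parallel>\<^sup>2\<close>. Its contraction factor \<open>\<kappa> / (1 + \<kappa>)\<close> is strictly smaller
  than \<open>\<rho>\<close>, and this slack is what rules out a factor \<open>k\<close> when \<open>\<beta> = \<rho>\<close>: relative to
  \<open>max \<beta> \<rho> ^ k\<close> the squared errors enter with geometrically decaying weights. If the weighted sum
  is large, then some squared error exceeds a threshold that grows linearly in its age, and a union
  bound over the ages costs only a convergent geometric series. Hence only the unconditional tails
  of the errors matter.
\<close>

section \<open>Lower semicontinuity and proximal points\<close>

text \<open>Passing from \<open>at x\<close> to \<open>nhds x\<close> costs nothing, because the
  inequality \<open>c < g x\<close> holds at the point itself. This form works with open sets and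
  avoids \<open>Liminf\<close>.\<close>

lemma lower_semicont_iff_eventually:
  "lower_semicont g \<longleftrightarrow> (\<forall>x. \<forall>c<g x. \<forall>\<^sub>F y in nhds x. c < g y)"
  unfolding lower_semicont_def le_Liminf_iff eventually_nhds_conv_at by auto

lemma lower_semicont_open:
  assumes "lower_semicont g"
  shows "open {x. c < g x}"
proof (subst open_subopen, intro ballI)
  fix x assume "x \<in> {x. c < g x}"
  then have "\<forall>\<^sub>F y in nhds x. c < g y"
    using assms unfolding lower_semicont_iff_eventually by simp
  then show "\<exists>T. open T \<and> x \<in> T \<and> T \<subseteq> {x. c < g x}"
    unfolding eventually_nhds by blast
qed

text \<open>Without a minimizer, the open sets \<open>{z. g y < g z}\<close> with \<open>y\<close>
  in \<open>K\<close> would cover \<open>K\<close>. In a finite subcover, the centre with the least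
  value lies in none of the sets.\<close>

lemma lower_semicont_attains_inf:
  assumes "lower_semicont g" "compact K" "K \<noteq> {}"
  shows "\<exists>x\<in>K. \<forall>y\<in>K. g x \<le> g y"
proof (rule ccontr)
  assume "\<not> ?thesis"
  then have cover: "K \<subseteq> (\<Union>y\<in>K. {z. g y < g z})" by force
  obtain T where T: "T \<subseteq> K" "finite T" "K \<subseteq> (\<Union>y\<in>T. {z. g y < g z})"
    using compactE_image[OF assms(2) _ cover] lower_semicont_open[OF assms(1)] by metis
  with assms(3) have "T \<noteq> {}" by auto
  then have "Min (g ` T) \<in> g ` T" using T by simp
  then obtain y where y: "y \<in> T" "g y = Min (g ` T)" by (metis imageE)
  then obtain y' where "y' \<in> T" "g y' < g y" using T by blast
  moreover have "g y \<le> g y'" using y \<open>y' \<in> T\<close> T(2) by simp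
  ultimately show False by simp
qed

lemma lower_semicont_scale_add:
  fixes g :: "'a::t2_space \<Rightarrow> ereal" and q :: "'a \<Rightarrow> real"
  assumes lsc: "lower_semicont g" and proper: "\<And>y. g y \<noteq> -\<infinity>"
    and q: "continuous_on UNIV q" and \<alpha>: "\<alpha> > 0"
  shows "lower_semicont (\<lambda>y. ereal \<alpha> * g y + ereal (q y))"
  unfolding lower_semicont_iff_eventually
proof (intro allI impI)
  fix x c assume c: "c < ereal \<alpha> * g x + ereal (q x)"
  \<comment> \<open>A real \<open>d\<close> below \<open>g x\<close> splits the inequality:
    \<open>g\<close> stays above \<open>d\<close> nearby by semicontinuity, and
    \<open>\<alpha> * d + q\<close> stays above \<open>c\<close> by continuity. This treats finite
    and infinite \<open>g x\<close> alike.\<close>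
  obtain d :: real where d: "ereal d < g x" "c < ereal (\<alpha> * d + q x)"
  proof (cases c)
    case MInf
    have "-\<infinity> < g x" using proper[of x] by simp
    then obtain d :: real where "ereal d < g x" using ereal_dense2 by blast
    then show ?thesis using that MInf by auto
  next
    case PInf
    with c show ?thesis by simp
  next
    case (real r)
    have "ereal ((r - q x) / \<alpha>) < g x"
      using c real proper[of x] \<alpha>
      by (cases "g x") (auto simp: field_simps)
    then obtain d :: real where "ereal ((r - q x) / \<alpha>) < ereal d" "ereal d < g x"
      using ereal_dense2 by blast
    then show ?thesis using that[of d] real \<alpha> by (auto simp: field_simps)
  qed
  have 1: "\<forall>\<^sub>F y in nhds x. ereal d < g y"
    using lsc d(1) unfolding lower_semicont_iff_eventually by simp
  have "isCont q x" using q by (simp add: continuous_on_eq_continuous_at)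
  then have "(q \<longlongrightarrow> q x) (nhds x)" unfolding isCont_def tendsto_at_iff_tendsto_nhds .
  then have "((\<lambda>y. ereal (\<alpha> * d + q y)) \<longlongrightarrow> ereal (\<alpha> * d + q x)) (nhds x)"
    by (intro tendsto_intros)
  then have 2: "\<forall>\<^sub>F y in nhds x. c < ereal (\<alpha> * d + q y)"
    using d(2) by (rule order_tendstoD)
  show "\<forall>\<^sub>F y in nhds x. c < ereal \<alpha> * g y + ereal (q y)"
    using 1 2
  proof eventually_elim
    case (elim y)
    have "ereal (\<alpha> * d + q y) \<le> ereal \<alpha> * g y + ereal (q y)"
      using elim(1) \<alpha> proper[of y] by (cases "g y") auto
    with elim(2) show ?case by simp
  qed
qed

section \<open>The proximal map of a proper convex lower semicontinuous function\<close>

locale proper_convex_lsc =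
  fixes g :: "'a::euclidean_space \<Rightarrow> ereal" and x0 :: 'a
  assumes proper: "g y \<noteq> -\<infinity>"
    and cvx: "ereal_convex g"
    and lsc: "lower_semicont g"
    and x0_dom: "g x0 \<noteq> \<infinity>"
begin

text \<open>Real arithmetic is done with \<open>G\<close>, which agrees with \<open>g\<close> where
  \<open>g\<close> is finite. Where \<open>g\<close> is infinite, \<open>G\<close> has the default
  value 0, hence the side conditions \<open>g y \<noteq> \<infinity>\<close> below.\<close>

definition G :: "'a \<Rightarrow> real" where "G y = real_of_ereal (g y)"

lemma g_eq: "g y \<noteq> \<infinity> \<Longrightarrow> g y = ereal (G y)"
  using proper[of y] unfolding G_def by (cases "g y") auto

lemma convexD:
  assumes "g x \<noteq> \<infinity>" "g y \<noteq> \<infinity>" "0 \<le> t" "t \<le> 1"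
  shows "g ((1 - t) *\<^sub>R x + t *\<^sub>R y) \<le> ereal ((1 - t) * G x + t * G y)"
proof -
  have "g ((1 - t) *\<^sub>R x + t *\<^sub>R y) \<le> ereal (1 - t) * g x + ereal t * g y"
    using cvx assms(3,4) unfolding ereal_convex_def by simp
  then show ?thesis unfolding g_eq[OF assms(1)] g_eq[OF assms(2)] by simp
qed

text \<open>Takes the place of a supporting hyperplane: \<open>g\<close> is bounded below on the
  unit ball around \<open>x0\<close> by compactness, and convexity along rays from \<open>x0\<close>
  propagates the bound with linear loss.\<close>

lemma linear_minorant:
  obtains K where "K \<ge> 0"
    "\<And>y. norm (y - x0) \<ge> 1 \<Longrightarrow> ereal (G x0 - K * norm (y - x0)) \<le> g y"
proof -
  obtain p where p: "p \<in> cball x0 1" "\<And>y. y \<in> cball x0 1 \<Longrightarrow> g p \<le> g y"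
    using lower_semicont_attains_inf[OF lsc compact_cball[of x0 1]] by auto
  have "g p \<le> g x0" using p(2)[of x0] by simp
  then have pdom: "g p \<noteq> \<infinity>" using x0_dom by auto
  show ?thesis
  proof (rule that[of "G x0 - G p"])
    show "G x0 - G p \<ge> 0" using \<open>g p \<le> g x0\<close> g_eq[OF pdom] g_eq[OF x0_dom] by simp
    fix y assume R: "norm (y - x0) \<ge> 1"
    define r where "r = norm (y - x0)"
    show "ereal (G x0 - (G x0 - G p) * norm (y - x0)) \<le> g y"
    proof (cases "g y = \<infinity>")
      case False
      \<comment> \<open>The point where the segment from \<open>x0\<close> to \<open>y\<close> meets
        the unit sphere around \<open>x0\<close>.\<close>
      let ?q = "(1 - 1 / r) *\<^sub>R x0 + (1 / r) *\<^sub>R y"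
      have r: "r \<ge> 1" using R r_def by simp
      have "?q - x0 = (1 / r) *\<^sub>R (y - x0)" by (simp add: algebra_simps)
      then have "norm (?q - x0) = 1" using r by (simp add: r_def[symmetric])
      then have "?q \<in> cball x0 1" by (simp add: dist_norm norm_minus_commute)
      then have "g p \<le> g ?q" by (rule p(2))
      also have "\<dots> \<le> ereal ((1 - 1 / r) * G x0 + 1 / r * G y)"
        using convexD[OF x0_dom False, of "1 / r"] r by simp
      finally have "G p \<le> (1 - 1 / r) * G x0 + 1 / r * G y"
        unfolding g_eq[OF pdom] by simp
      then have "r * G p \<le> r * ((1 - 1 / r) * G x0 + 1 / r * G y)"
        using r by (intro mult_left_mono) auto
      also have "\<dots> = (r - 1) * G x0 + G y" using r by (simp add: field_simps)
      finally show ?thesis using g_eq[OF False] by (simp add: r_def[symmetric] algebra_simps)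
    qed simp
  qed
qed

text \<open>Since \<open>prox\<close> is a choice by \<open>arg_min\<close>, a minimizer must be
  shown to exist. The quadratic term beats the linear minorant far from \<open>x0\<close>, so
  minimizing over a large compact ball suffices.\<close>

lemma prox_minimizes:
  assumes \<alpha>: "\<alpha> > 0"
  shows "ereal \<alpha> * g (prox g \<alpha> z) + ereal (1 / 2 * (norm (z - prox g \<alpha> z))\<^sup>2)
           \<le> ereal \<alpha> * g y + ereal (1 / 2 * (norm (z - y))\<^sup>2)"
proof -
  define F where "F = (\<lambda>y. ereal \<alpha> * g y + ereal (1 / 2 * (norm (z - y))\<^sup>2))"
  obtain K where K: "K \<ge> 0" "\<And>y. norm (y - x0) \<ge> 1 \<Longrightarrow> ereal (G x0 - K * norm (y - x0)) \<le> g y"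
    using linear_minorant by blast
  define D where "D = norm (z - x0)"
  \<comment> \<open>For \<open>r > R\<close>, the inequality
    \<open>r * r \<ge> r * (2 * D + 2 * \<alpha> * K)\<close> turns
    \<open>(r - D)\<^sup>2 / 2 - \<alpha> * K * r\<close> into at least
    \<open>D\<^sup>2 / 2\<close>, the quadratic term at \<open>x0\<close>. The summand 1 brings
    \<open>y\<close> into the range of the minorant.\<close>
  define R where "R = 1 + 2 * D + 2 * \<alpha> * K"
  have D: "D \<ge> 0" by (simp add: D_def)
  have R1: "R \<ge> 1" using D K \<alpha> by (simp add: R_def)
  have "lower_semicont F"
    unfolding F_def by (rule lower_semicont_scale_add[OF lsc proper _ \<alpha>]) (intro continuous_intros)
  then obtain p where p: "p \<in> cball x0 R" "\<And>y. y \<in> cball x0 R \<Longrightarrow> F p \<le> F y"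
    using lower_semicont_attains_inf[of F "cball x0 R"] R1 by auto
  have far: "F x0 \<le> F y" if "y \<notin> cball x0 R" for y
  proof (cases "g y = \<infinity>")
    case True
    then show ?thesis using \<alpha> by (simp add: F_def)
  next
    case False
    define r where "r = norm (y - x0)"
    have r: "r > R" using that by (simp add: r_def dist_norm norm_minus_commute)
    have b: "G x0 - K * r \<le> G y"
      using K(2)[of y] r R1 g_eq[OF False] by (simp add: r_def)
    have "y - x0 = (z - x0) - (z - y)" by simp
    then have "r \<le> D + norm (z - y)" unfolding r_def D_def by (metis norm_triangle_ineq4)
    moreover have "r \<ge> D" using r R1 D K \<alpha> unfolding R_def by (smt (verit) mult_nonneg_nonneg)
    ultimately have "(r - D)\<^sup>2 \<le> (norm (z - y))\<^sup>2" by (intro power_mono) auto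
    moreover have "r * (2 * D + 2 * \<alpha> * K) \<le> r * r"
      using r R1 by (intro mult_left_mono) (auto simp: R_def)
    moreover have "\<alpha> * (G x0 - K * r) \<le> \<alpha> * G y" using b \<alpha> by (intro mult_left_mono) auto
    ultimately have "\<alpha> * G x0 + 1 / 2 * D\<^sup>2 \<le> \<alpha> * G y + 1 / 2 * (norm (z - y))\<^sup>2"
      by (simp add: power2_eq_square algebra_simps)
    then show ?thesis unfolding F_def using g_eq[OF False] g_eq[OF x0_dom] by (simp add: D_def)
  qed
  have "F p \<le> F y" for y
    using p(2)[of y] p(2)[of x0] far[of y] R1 by (cases "y \<in> cball x0 R") auto
  then have "is_arg_min F (\<lambda>_. True) p" by (auto simp: is_arg_min_def not_less)
  then have "is_arg_min F (\<lambda>_. True) (prox g \<alpha> z)"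
    unfolding prox_def arg_min_def F_def by (rule someI)
  then show ?thesis by (auto simp: is_arg_min_def not_less F_def)
qed

lemma prox_dom:
  assumes "\<alpha> > 0"
  shows "g (prox g \<alpha> z) \<noteq> \<infinity>"
  using prox_minimizes[OF assms, of z x0] g_eq[OF x0_dom] assms by auto

text \<open>First-order optimality: compare \<open>p\<close> with a point at fraction
  \<open>t\<close> of the way to \<open>y\<close>, divide by \<open>t\<close>, and let
  \<open>t\<close> tend to 0. The limit is replaced by an arbitrary slack \<open>d\<close>.\<close>

lemma prox_variational:
  fixes z :: 'a
  assumes \<alpha>: "\<alpha> > 0" and y: "g y \<noteq> \<infinity>"
  defines "p \<equiv> prox g \<alpha> z"
  shows "\<alpha> * G p + (z - p) \<bullet> (y - p) \<le> \<alpha> * G y"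
proof (rule field_le_epsilon)
  fix d :: real assume d: "d > 0"
  define N where "N = (norm (y - p))\<^sup>2"
  have N: "N \<ge> 0" by (simp add: N_def)
  \<comment> \<open>Small enough that the second-order remainder \<open>t * N / 2\<close> is at most
    \<open>d\<close>; the 1 in the denominator covers \<open>N = 0\<close>.\<close>
  define t where "t = min 1 (d / (1 + N))"
  have t: "0 < t" "t \<le> 1" using d N by (auto simp: t_def)
  have pdom: "g p \<noteq> \<infinity>" unfolding p_def by (rule prox_dom[OF \<alpha>])
  define w where "w = (1 - t) *\<^sub>R p + t *\<^sub>R y"
  have gw: "g w \<le> ereal ((1 - t) * G p + t * G y)"
    unfolding w_def using convexD[OF pdom y] t by simp
  then have wdom: "g w \<noteq> \<infinity>" by auto
  have Gw: "G w \<le> (1 - t) * G p + t * G y" using gw g_eq[OF wdom] by simp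
  have zw: "z - w = (z - p) - t *\<^sub>R (y - p)" by (simp add: w_def algebra_simps)
  have sq: "(norm (z - w))\<^sup>2 = (norm (z - p))\<^sup>2 - 2 * t * ((z - p) \<bullet> (y - p)) + t\<^sup>2 * N"
    unfolding zw N_def power2_norm_eq_inner
    by (simp add: inner_diff_left inner_diff_right inner_commute power2_eq_square algebra_simps)
  have "\<alpha> * G p + 1 / 2 * (norm (z - p))\<^sup>2 \<le> \<alpha> * G w + 1 / 2 * (norm (z - w))\<^sup>2"
    using prox_minimizes[OF \<alpha>, of z w] g_eq[OF wdom] g_eq[OF pdom] by (simp add: p_def)
  also have "\<dots> \<le> \<alpha> * ((1 - t) * G p + t * G y) + 1 / 2 * (norm (z - w))\<^sup>2"
    using Gw \<alpha> by simp
  finally have "t * (\<alpha> * G p + (z - p) \<bullet> (y - p)) \<le> t * (\<alpha> * G y + t * N / 2)"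
    unfolding sq by (simp add: power2_eq_square algebra_simps)
  then have "\<alpha> * G p + (z - p) \<bullet> (y - p) \<le> \<alpha> * G y + t * N / 2" using t by simp
  moreover have "t * N / 2 \<le> d"
  proof -
    have "t * N \<le> d / (1 + N) * N" using N by (intro mult_right_mono) (auto simp: t_def)
    also have "\<dots> \<le> d" using N d by (simp add: field_simps)
    finally show ?thesis using d by simp
  qed
  ultimately show "\<alpha> * G p + (z - p) \<bullet> (y - p) \<le> \<alpha> * G y + d" by simp
qed

text \<open>Testing the variational inequality of each proximal point at the other one and adding
  gives firm nonexpansiveness; Cauchy-Schwarz does the rest.\<close>

lemma prox_nonexpansive:
  assumes \<alpha>: "\<alpha> > 0"
  shows "norm (prox g \<alpha> z - prox g \<alpha> z') \<le> norm (z - z')"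
proof -
  define p q where "p = prox g \<alpha> z" and "q = prox g \<alpha> z'"
  have "\<alpha> * G p + (z - p) \<bullet> (q - p) \<le> \<alpha> * G q" "\<alpha> * G q + (z' - q) \<bullet> (p - q) \<le> \<alpha> * G p"
    unfolding p_def q_def using prox_variational[OF \<alpha> prox_dom[OF \<alpha>]] by blast+
  then have "norm (p - q) * norm (p - q) \<le> (z - z') \<bullet> (p - q)"
    unfolding power2_eq_square[symmetric] power2_norm_eq_inner
    by (simp add: inner_diff_left inner_diff_right inner_commute algebra_simps)
  also have "\<dots> \<le> norm (z - z') * norm (p - q)" by (rule norm_cauchy_schwarz)
  finally show ?thesis unfolding p_def[symmetric] q_def[symmetric]
    by (cases "p = q") auto
qed

end

section \<open>One step of the inexact iteration\<close>

text \<open>Along the segment, \<open>\<phi>\<close> is \<open>f\<close> minus the varying part of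
  its quadratic model. Cauchy-Schwarz and the Lipschitz bound make its derivative nonpositive, so
  comparing the endpoints gives the claim.\<close>

lemma lipschitz_gradient_upper_bound:
  fixes f :: "'a::euclidean_space \<Rightarrow> real"
  assumes grad: "\<And>y. GDERIV f y :> D y"
    and lip: "\<And>y z. norm (D z - D y) \<le> L * norm (z - y)"
  shows "f y \<le> f x + D x \<bullet> (y - x) + L / 2 * (norm (y - x))\<^sup>2"
proof -
  define v where "v = y - x"
  define \<phi> where "\<phi> = (\<lambda>t. f (x + t *\<^sub>R v) - t * (D x \<bullet> v) - L / 2 * t\<^sup>2 * (norm v)\<^sup>2)"
  have "\<phi> 1 \<le> \<phi> 0"
  proof (rule DERIV_nonpos_imp_nonincreasing[of 0 1 \<phi>])
    fix t :: real assume t: "0 \<le> t" "t \<le> 1"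
    have "((\<lambda>t. f (x + t *\<^sub>R v)) has_derivative (\<lambda>h. (h *\<^sub>R v) \<bullet> D (x + t *\<^sub>R v))) (at t)"
      by (rule has_derivative_compose[where f = "\<lambda>t. x + t *\<^sub>R v"])
         (use grad in \<open>auto simp: gderiv_def intro!: derivative_eq_intros\<close>)
    then have "((\<lambda>t. f (x + t *\<^sub>R v)) has_real_derivative v \<bullet> D (x + t *\<^sub>R v)) (at t)"
      by (rule has_derivative_imp_has_field_derivative) simp
    then have der: "(\<phi> has_real_derivative v \<bullet> D (x + t *\<^sub>R v) - D x \<bullet> v - L * t * (norm v)\<^sup>2) (at t)"
      unfolding \<phi>_def by (auto intro!: derivative_eq_intros)
    have "v \<bullet> D (x + t *\<^sub>R v) - D x \<bullet> v = (D (x + t *\<^sub>R v) - D x) \<bullet> v"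
      by (simp add: inner_diff_left inner_diff_right inner_commute)
    also have "\<dots> \<le> norm (D (x + t *\<^sub>R v) - D x) * norm v" by (rule norm_cauchy_schwarz)
    also have "\<dots> \<le> L * norm (x + t *\<^sub>R v - x) * norm v" using lip by (intro mult_right_mono norm_ge_zero)
    also have "\<dots> = L * t * (norm v)\<^sup>2" using t by (simp add: power2_eq_square)
    finally show "\<exists>y. (\<phi> has_real_derivative y) (at t) \<and> y \<le> 0" using der by force
  qed simp
  then show ?thesis by (simp add: \<phi>_def v_def)
qed

text \<open>The upper bound for \<open>- f\<close>. It stands in for the gradient inequality of a
  convex function.\<close>

lemma lipschitz_gradient_lower_bound:
  fixes f :: "'a::euclidean_space \<Rightarrow> real"
  assumes grad: "\<And>y. GDERIV f y :> D y"
    and lip: "\<And>y z. norm (D z - D y) \<le> L * norm (z - y)"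
  shows "f x + D x \<bullet> (y - x) - L / 2 * (norm (y - x))\<^sup>2 \<le> f y"
proof -
  have "GDERIV (\<lambda>y. - f y) z :> - D z" for z by (rule GDERIV_minus[OF grad])
  moreover have "norm (- D z - - D y) \<le> L * norm (z - y)" for y z
    using lip[of z y] by (simp add: norm_minus_commute)
  ultimately show ?thesis
    using lipschitz_gradient_upper_bound[of "\<lambda>y. - f y" "\<lambda>y. - D y" L y x] by simp
qed

text \<open>Carries a bound at each point of \<open>S\<close> over to the distance without a nearest
  point: for positive \<open>c\<close>, \<open>sqrt (c / L)\<close> is a lower bound of all
  distances, hence of their infimum.\<close>

lemma le_infdist_square:
  fixes S :: "'a::metric_space set"
  assumes "S \<noteq> {}" "L > 0" "\<And>s. s \<in> S \<Longrightarrow> c \<le> L * (dist x s)\<^sup>2"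
  shows "c \<le> L * (infdist x S)\<^sup>2"
proof (cases "c \<le> 0")
  case True
  then show ?thesis using assms(2) by (smt (verit) mult_nonneg_nonneg zero_le_power2)
next
  case False
  have "sqrt (c / L) \<le> dist x s" if "s \<in> S" for s
    using assms(2) assms(3)[OF that] by (intro real_le_lsqrt) (auto simp: field_simps)
  then have "sqrt (c / L) \<le> infdist x S"
    using assms(1) by (auto simp: infdist_def intro!: cINF_greatest)
  then have "(sqrt (c / L))\<^sup>2 \<le> (infdist x S)\<^sup>2" using False assms(2) by (intro power_mono) auto
  then show ?thesis using False assms(2) by (simp add: field_simps)
qed

text \<open>Here \<open>S\<close> stands for the solution set and \<open>m\<close> for the minimal
  value as a real number, so that the step estimates stay in real arithmetic.\<close>

locale prox_gradient = proper_convex_lsc g x0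
  for g :: "'a::euclidean_space \<Rightarrow> ereal" and x0 :: 'a +
  fixes f :: "'a \<Rightarrow> real" and gradf :: "'a \<Rightarrow> 'a" and S :: "'a set" and L \<tau> m :: real
  assumes grad: "GDERIV f y :> gradf y"
    and lip: "norm (gradf z - gradf y) \<le> L * norm (z - y)"
    and L_pos: "L > 0"
    and S_nonempty: "S \<noteq> {}"
    and S_dom: "s \<in> S \<Longrightarrow> g s \<noteq> \<infinity>"
    and S_val: "s \<in> S \<Longrightarrow> f s + G s = m"
    and error_bound: "infdist y S \<le> \<tau> * norm (y - prox g (1 / L) (y - (1 / L) *\<^sub>R gradf y))"
begin

text \<open>The variational inequality multiplied by \<open>L\<close>: the vector
  \<open>L *\<^sub>R (x - p) - gradf x - e\<close> is a subgradient of \<open>g\<close> at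
  \<open>p\<close>.\<close>

lemma step_variational:
  fixes x e :: 'a
  assumes y: "g y \<noteq> \<infinity>"
  defines "p \<equiv> prox g (1 / L) (x - (1 / L) *\<^sub>R (gradf x + e))"
  shows "G p + (L *\<^sub>R (x - p) - gradf x - e) \<bullet> (y - p) \<le> G y"
proof -
  let ?z = "x - (1 / L) *\<^sub>R (gradf x + e)"
  have "L *\<^sub>R (?z - p) = L *\<^sub>R (x - p) - gradf x - e"
    using L_pos by (simp add: algebra_simps)
  then have *: "(L *\<^sub>R (x - p) - gradf x - e) \<bullet> (y - p) = L * ((?z - p) \<bullet> (y - p))"
    by (metis inner_scaleR_left)
  have "1 / L * G p + (?z - p) \<bullet> (y - p) \<le> 1 / L * G y"
    unfolding p_def by (rule prox_variational[OF _ y]) (use L_pos in simp)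
  then have "L * (1 / L * G p + (?z - p) \<bullet> (y - p)) \<le> L * (1 / L * G y)"
    using L_pos by (intro mult_left_mono) auto
  then show ?thesis unfolding * using L_pos by (simp add: distrib_left)
qed

text \<open>Testing the subgradient at \<open>x\<close> gains \<open>L\<close> times the squared
  step length, of which the quadratic upper bound on \<open>f\<close> takes back half.\<close>

lemma step_descent:
  fixes x e :: 'a
  assumes x: "g x \<noteq> \<infinity>"
  defines "p \<equiv> prox g (1 / L) (x - (1 / L) *\<^sub>R (gradf x + e))"
  shows "f p + G p \<le> f x + G x - L / 2 * (norm (x - p))\<^sup>2 + e \<bullet> (x - p)"
proof -
  have "f p \<le> f x + gradf x \<bullet> (p - x) + L / 2 * (norm (p - x))\<^sup>2"
    by (rule lipschitz_gradient_upper_bound[OF grad lip])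
  moreover have "G p + (L *\<^sub>R (x - p) - gradf x - e) \<bullet> (x - p) \<le> G x"
    unfolding p_def by (rule step_variational[OF x])
  moreover have "(norm (p - x))\<^sup>2 = (norm (x - p))\<^sup>2" by (simp add: norm_minus_commute)
  moreover have "(L *\<^sub>R (x - p) - gradf x - e) \<bullet> (x - p)
      = L * (norm (x - p))\<^sup>2 + gradf x \<bullet> (p - x) - e \<bullet> (x - p)"
    by (simp add: power2_norm_eq_inner inner_diff_left inner_diff_right algebra_simps)
  ultimately show ?thesis by simp
qed

text \<open>The subgradient is tested at \<open>s\<close>. The factor \<open>L\<close> collects one
  half from the lower bound on \<open>f\<close> and one half from expanding
  \<open>(x - p) \<bullet> (s - p)\<close>; the squares of \<open>p - x\<close> cancel.\<close>

lemma step_gap_le_distance: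
  fixes x e :: 'a
  assumes s: "s \<in> S"
  defines "p \<equiv> prox g (1 / L) (x - (1 / L) *\<^sub>R (gradf x + e))"
  shows "f p + G p - m \<le> L * (dist x s)\<^sup>2 + (norm e)\<^sup>2 / (2 * L)"
proof -
  have 1: "f p \<le> f x + gradf x \<bullet> (p - x) + L / 2 * (norm (p - x))\<^sup>2"
    by (rule lipschitz_gradient_upper_bound[OF grad lip])
  have 2: "f x + gradf x \<bullet> (s - x) - L / 2 * (norm (s - x))\<^sup>2 \<le> f s"
    by (rule lipschitz_gradient_lower_bound[OF grad lip])
  have 3: "G p + (L *\<^sub>R (x - p) - gradf x - e) \<bullet> (s - p) \<le> G s"
    unfolding p_def by (rule step_variational[OF S_dom[OF s]])
  have "s - x = (s - p) - (x - p)" by simp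
  then have "(norm (s - x))\<^sup>2 = (norm (s - p))\<^sup>2 + (norm (p - x))\<^sup>2 - 2 * ((x - p) \<bullet> (s - p))"
    unfolding power2_norm_eq_inner
    by (simp add: inner_diff_left inner_diff_right inner_commute algebra_simps)
  then have "(x - p) \<bullet> (s - p) = ((norm (s - p))\<^sup>2 + (norm (p - x))\<^sup>2 - (norm (s - x))\<^sup>2) / 2"
    by simp
  then have 4: "L * ((x - p) \<bullet> (s - p)) = L / 2 * (norm (s - p))\<^sup>2 + L / 2 * (norm (p - x))\<^sup>2
      - L / 2 * (norm (s - x))\<^sup>2"
    by (simp only:) (simp add: field_simps)
  \<comment> \<open>Young's inequality: the left-over
    \<open>- L / 2 * (norm (s - p))\<^sup>2\<close> absorbs the error term.\<close>
  have 5: "e \<bullet> (s - p) - L / 2 * (norm (s - p))\<^sup>2 \<le> (norm e)\<^sup>2 / (2 * L)"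
  proof -
    have "0 \<le> (norm e - L * norm (s - p))\<^sup>2 / (2 * L)" using L_pos by simp
    also have "\<dots> = (norm e)\<^sup>2 / (2 * L) - norm e * norm (s - p) + L / 2 * (norm (s - p))\<^sup>2"
      using L_pos by (simp add: power2_eq_square field_simps)
    finally show ?thesis using norm_cauchy_schwarz[of e "s - p"] by linarith
  qed
  have 6: "(L *\<^sub>R (x - p) - gradf x - e) \<bullet> (s - p)
      = L * ((x - p) \<bullet> (s - p)) - gradf x \<bullet> (s - p) - e \<bullet> (s - p)"
    by (simp add: inner_diff_left)
  have 7: "gradf x \<bullet> (s - p) = gradf x \<bullet> (s - x) - gradf x \<bullet> (p - x)"
    by (simp add: inner_diff_right)
  have "dist x s = norm (s - x)" by (simp add: dist_norm norm_minus_commute)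
  then show ?thesis using 1 2 3 4 5 6 7 S_val[OF s] by (simp add: field_simps)
qed

text \<open>The new gap is controlled by the squared step length plus error, and the squared step
  length by the decrease of the gap plus error. Solving for the new gap gives the
  contraction.\<close>

lemma step_contraction:
  fixes x e :: 'a
  assumes x: "g x \<noteq> \<infinity>"
  defines "p \<equiv> prox g (1 / L) (x - (1 / L) *\<^sub>R (gradf x + e))"
  shows "f p + G p - m \<le> 8 * \<tau>\<^sup>2 / (1 + 8 * \<tau>\<^sup>2) * (f x + G x - m)
           + (10 * \<tau>\<^sup>2 + 1) / L * (norm e)\<^sup>2"
proof -
  \<comment> \<open>The error bound concerns the exact step \<open>u\<close>, whereas the descent
    concerns the inexact step \<open>p\<close>; nonexpansiveness keeps them within
    \<open>\<epsilon> / L\<close> of each other.\<close>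
  define u where "u = prox g (1 / L) (x - (1 / L) *\<^sub>R gradf x)"
  define a where "a = norm (x - p)"
  define \<epsilon> where "\<epsilon> = norm e"
  define r where "r = norm (x - u)"
  define P where "P = f x + G x - m"
  define P' where "P' = f p + G p - m"
  have "P' - \<epsilon>\<^sup>2 / (2 * L) \<le> L * (infdist x S)\<^sup>2"
    using step_gap_le_distance[of _ x e] S_nonempty L_pos
    by (intro le_infdist_square) (auto simp: P'_def p_def \<epsilon>_def algebra_simps)
  also have "\<dots> \<le> L * (\<tau> * r)\<^sup>2"
    using error_bound[of x] L_pos infdist_nonneg[of x S]
    by (intro mult_left_mono power_mono) (auto simp: r_def u_def)
  finally have 1: "P' \<le> L * \<tau>\<^sup>2 * r\<^sup>2 + \<epsilon>\<^sup>2 / (2 * L)" by (simp add: power_mult_distrib)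
  have "norm (p - u) \<le> norm ((x - (1 / L) *\<^sub>R (gradf x + e)) - (x - (1 / L) *\<^sub>R gradf x))"
    unfolding p_def u_def by (rule prox_nonexpansive) (use L_pos in simp)
  also have "\<dots> = \<epsilon> / L" using L_pos by (simp add: \<epsilon>_def algebra_simps)
  finally have "r \<le> a + \<epsilon> / L"
    using norm_triangle_ineq[of "x - p" "p - u"] by (simp add: r_def a_def)
  then have "r\<^sup>2 \<le> (a + \<epsilon> / L)\<^sup>2" by (intro power_mono) (auto simp: r_def)
  also have "\<dots> \<le> 2 * a\<^sup>2 + 2 * (\<epsilon> / L)\<^sup>2"
    using zero_le_power2[of "a - \<epsilon> / L"] by (simp add: power2_diff power2_sum)
  finally have "L * \<tau>\<^sup>2 * r\<^sup>2 \<le> L * \<tau>\<^sup>2 * (2 * a\<^sup>2 + 2 * (\<epsilon> / L)\<^sup>2)"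
    using L_pos by (intro mult_left_mono) auto
  also have "\<dots> = 8 * \<tau>\<^sup>2 * (L / 4 * a\<^sup>2) + 2 * \<tau>\<^sup>2 * (\<epsilon>\<^sup>2 / L)"
    using L_pos by (simp add: power2_eq_square field_simps)
  finally have 2: "L * \<tau>\<^sup>2 * r\<^sup>2 \<le> 8 * \<tau>\<^sup>2 * (L / 4 * a\<^sup>2) + 2 * \<tau>\<^sup>2 * (\<epsilon>\<^sup>2 / L)" .
  \<comment> \<open>Young's inequality spends half of the descent term on the error and keeps
    \<open>L / 4 * a\<^sup>2\<close>. With the factor 2 from squaring the sum, this is the origin of
    8.\<close>
  have "0 \<le> (\<epsilon> - L / 2 * a)\<^sup>2 / L" using L_pos by simp
  also have "\<dots> = \<epsilon>\<^sup>2 / L - \<epsilon> * a + L / 4 * a\<^sup>2"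
    using L_pos by (simp add: power2_eq_square field_simps)
  finally have "e \<bullet> (x - p) \<le> \<epsilon>\<^sup>2 / L + L / 4 * a\<^sup>2"
    using norm_cauchy_schwarz[of e "x - p"] unfolding a_def \<epsilon>_def by linarith
  then have "L / 4 * a\<^sup>2 \<le> P - P' + \<epsilon>\<^sup>2 / L"
    using step_descent[OF x, of e] unfolding P_def P'_def a_def p_def[symmetric] by argo
  then have "8 * \<tau>\<^sup>2 * (L / 4 * a\<^sup>2) \<le> 8 * \<tau>\<^sup>2 * (P - P' + \<epsilon>\<^sup>2 / L)"
    by (intro mult_left_mono) auto
  moreover have "\<epsilon>\<^sup>2 / (2 * L) = \<epsilon>\<^sup>2 / L / 2" by simp
  ultimately have "(1 + 8 * \<tau>\<^sup>2) * P' \<le> 8 * \<tau>\<^sup>2 * P + (10 * \<tau>\<^sup>2 + 1 / 2) * (\<epsilon>\<^sup>2 / L)"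
    using 1 2 by argo
  \<comment> \<open>The error coefficient is enlarged by the factor
    \<open>1 + 8 * \<tau>\<^sup>2\<close>, which the division below removes again.\<close>
  also have "\<dots> \<le> 8 * \<tau>\<^sup>2 * P + (1 + 8 * \<tau>\<^sup>2) * ((10 * \<tau>\<^sup>2 + 1) * (\<epsilon>\<^sup>2 / L))"
  proof -
    have "(10 * \<tau>\<^sup>2 + 1 / 2) * (\<epsilon>\<^sup>2 / L) \<le> 1 * ((10 * \<tau>\<^sup>2 + 1) * (\<epsilon>\<^sup>2 / L))"
      using L_pos unfolding mult_1 by (intro mult_right_mono) auto
    also have "\<dots> \<le> (1 + 8 * \<tau>\<^sup>2) * ((10 * \<tau>\<^sup>2 + 1) * (\<epsilon>\<^sup>2 / L))"
      using L_pos by (intro mult_right_mono) auto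
    finally show ?thesis by simp
  qed
  finally have *: "(1 + 8 * \<tau>\<^sup>2) * P' \<le> 8 * \<tau>\<^sup>2 * P + (1 + 8 * \<tau>\<^sup>2) * ((10 * \<tau>\<^sup>2 + 1) * (\<epsilon>\<^sup>2 / L))" .
  have pos: "1 + 8 * \<tau>\<^sup>2 > 0" by (simp add: add_pos_nonneg)
  have "P' \<le> (8 * \<tau>\<^sup>2 * P + (1 + 8 * \<tau>\<^sup>2) * ((10 * \<tau>\<^sup>2 + 1) * (\<epsilon>\<^sup>2 / L))) / (1 + 8 * \<tau>\<^sup>2)"
    using * pos by (simp add: pos_le_divide_eq mult.commute)
  also have "\<dots> = 8 * \<tau>\<^sup>2 / (1 + 8 * \<tau>\<^sup>2) * P + (10 * \<tau>\<^sup>2 + 1) / L * \<epsilon>\<^sup>2"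
    using pos by (simp add: add_divide_distrib[of "8 * \<tau>\<^sup>2 * P"])
  finally show ?thesis by (simp add: P_def P'_def \<epsilon>_def)
qed

end

section \<open>Tail bounds\<close>

lemma linear_recursion_le:
  fixes a b :: "nat \<Rightarrow> real"
  assumes "\<And>k. a (Suc k) \<le> q * a k + b k" "q \<ge> 0"
  shows "a k \<le> q ^ k * a 0 + (\<Sum>i<k. q ^ (k - Suc i) * b i)"
proof (induction k)
  case (Suc k)
  have "a (Suc k) \<le> q * a k + b k" by (rule assms)
  also have "\<dots> \<le> q * (q ^ k * a 0 + (\<Sum>i<k. q ^ (k - Suc i) * b i)) + b k"
    using Suc assms(2) by (simp add: mult_left_mono)
  also have "\<dots> = q ^ Suc k * a 0 + (\<Sum>i<k. q * q ^ (k - Suc i) * b i) + b k"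
    by (simp add: distrib_left sum_distrib_left mult.assoc)
  also have "(\<Sum>i<k. q * q ^ (k - Suc i) * b i) = (\<Sum>i<k. q ^ (Suc k - Suc i) * b i)"
    by (intro sum.cong) (auto simp: power_Suc[symmetric] Suc_diff_Suc simp del: power_Suc)
  finally show ?case by simp
qed simp

text \<open>Geometric weights absorb a bound growing linearly in the age \<open>k - i\<close>, by
  the derivative of the geometric series. Strictness is what later contradicts a sum of at least
  \<open>\<epsilon>\<close>.\<close>

lemma weighted_geometric_sum_less:
  fixes r :: real
  assumes r: "0 \<le> r" "r < 1" and k: "k > 0" and B: "B \<ge> 0" and b: "\<And>i. i < k \<Longrightarrow> b i < B * real (k - i)"
  shows "(\<Sum>i<k. r ^ (k - Suc i) * b i) < B / (1 - r)\<^sup>2"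
proof -
  obtain n where n: "k = Suc n" using k by (cases k) auto
  have sums: "(\<lambda>j. real (Suc j) * r ^ j) sums (1 / (1 - r)\<^sup>2)"
    using geometric_deriv_sums[of r] r by simp
  have "(\<Sum>i<k. r ^ (k - Suc i) * b i) < (\<Sum>i<k. r ^ (k - Suc i) * (B * real (k - i)))"
  proof (rule sum_strict_mono_ex1)
    show "\<forall>i\<in>{..<k}. r ^ (k - Suc i) * b i \<le> r ^ (k - Suc i) * (B * real (k - i))"
      using less_imp_le[OF b] r by (intro ballI mult_left_mono) auto
    \<comment> \<open>At the last index the weight is \<open>r ^ 0 = 1\<close>, so strictness
      survives even for \<open>r = 0\<close>.\<close>
    show "\<exists>i\<in>{..<k}. r ^ (k - Suc i) * b i < r ^ (k - Suc i) * (B * real (k - i))"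
      using b[of n] n by (intro bexI[of _ n]) auto
  qed simp
  also have "\<dots> = (\<Sum>j<k. r ^ j * (B * real (Suc j)))"
    by (rule sum.reindex_bij_witness[of _ "\<lambda>j. k - Suc j" "\<lambda>i. k - Suc i"]) auto
  also have "\<dots> = B * (\<Sum>j<k. real (Suc j) * r ^ j)"
    by (simp add: sum_distrib_left mult_ac)
  also have "\<dots> \<le> B * (1 / (1 - r)\<^sup>2)"
  proof (intro mult_left_mono B)
    show "(\<Sum>j<k. real (Suc j) * r ^ j) \<le> 1 / (1 - r)\<^sup>2"
      unfolding sums_unique[OF sums]
      using r by (intro sum_le_suminf sums_summable[OF sums]) auto
  qed
  finally show ?thesis by simp
qed

text \<open>The ages start at 1 and the ratio \<open>exp (- q)\<close> is at most 1/2, so the sum is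
  at most twice its largest possible term.\<close>

lemma exp_tail_sum_le:
  fixes q :: real
  assumes "q \<ge> 1"
  shows "(\<Sum>i<k. exp (- q * real (k - i))) \<le> 2 * exp (- q)"
proof -
  have "2 \<le> exp q" using assms exp_ge_add_one_self[of q] by linarith
  then have q2: "exp (- q) \<le> 1 / 2" by (simp add: exp_minus field_simps)
  have "(\<Sum>i<k. exp (- q * real (k - i))) = (\<Sum>j<k. exp (- q) * exp (- q) ^ j)"
    by (rule sum.reindex_bij_witness[of _ "\<lambda>j. k - Suc j" "\<lambda>i. k - Suc i"])
       (auto simp: exp_of_nat_mult[symmetric] exp_add[symmetric] algebra_simps of_nat_diff)
  also have "\<dots> = exp (- q) * (\<Sum>j<k. exp (- q) ^ j)" by (simp add: sum_distrib_left)
  also have "\<dots> \<le> exp (- q) * (1 / (1 - exp (- q)))"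
  proof (intro mult_left_mono)
    have "(\<lambda>j. exp (- q) ^ j) sums (1 / (1 - exp (- q)))"
      using assms by (intro geometric_sums) simp
    then show "(\<Sum>j<k. exp (- q) ^ j) \<le> 1 / (1 - exp (- q))"
      by (metis finite_lessThan sum_le_suminf sums_summable sums_unique exp_ge_zero zero_le_power)
  qed simp
  also have "\<dots> \<le> exp (- q) * 2"
  proof (intro mult_left_mono)
    have "1 / (1 - exp (- q)) \<le> 1 / (1 / 2)" using q2 by (intro divide_left_mono mult_pos_pos) linarith+
    then show "1 / (1 - exp (- q)) \<le> 2" by simp
  qed simp
  finally show ?thesis by simp
qed

section \<open>From conditional component tails to tails of the squared norm\<close>

context prob_space
begin

lemma past_algebra_subalgebra:
  fixes e :: "nat \<Rightarrow> 'a \<Rightarrow> 'b::topological_space"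
  assumes "\<And>k. e k \<in> borel_measurable M"
  shows "subalgebra M (past_algebra M e k)"
proof -
  have "(\<Union>j<k. {e j -` A \<inter> space M | A. A \<in> sets borel}) \<subseteq> sets M"
    using assms by (auto intro: measurable_sets)
  then show ?thesis
    unfolding subalgebra_def past_algebra_def
    by (auto simp: space_measure_of_conv sets_measure_of_conv sets.sets_into_space
        intro!: sets.sigma_sets_subset)
qed

text \<open>Integrate the conditional bound: a conditional expectation has the same mean as the
  indicator.\<close>

lemma prob_le_of_cond_pr_le:
  assumes F: "subalgebra M F" and P: "{\<omega> \<in> space M. P \<omega>} \<in> events"
    and le: "AE \<omega> in M. cond_pr M F P \<omega> \<le> c"
  shows "\<P>(\<omega> in M. P \<omega>) \<le> c"
proof -
  interpret finite_measure_subalgebra M F by unfold_locales (rule F)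
  let ?I = "indicator {\<omega> \<in> space M. P \<omega>} :: 'a \<Rightarrow> real"
  have int: "integrable M ?I"
    using P by (intro integrable_real_indicator) (auto simp: emeasure_eq_measure)
  have "\<P>(\<omega> in M. P \<omega>) = (\<integral>\<omega>. ?I \<omega> \<partial>M)" using P by simp
  also have "\<dots> = (\<integral>\<omega>. real_cond_exp M F ?I \<omega> \<partial>M)" using real_cond_exp_int(2)[OF int] by simp
  also have "\<dots> \<le> (\<integral>\<omega>. c \<partial>M)"
    using real_cond_exp_int(1)[OF int] le by (intro integral_mono_AE) (auto simp: cond_pr_def)
  finally show ?thesis by (simp add: prob_space)
qed

text \<open>If the squared norm reaches \<open>A\<close>, some component reaches
  \<open>sqrt (A / n)\<close> in absolute value; a union bound over both signs of all components
  follows.\<close>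

lemma norm_square_tail:
  fixes X :: "'a \<Rightarrow> real ^ 'n"
  assumes X: "X \<in> borel_measurable M" and A: "A > 0" and u: "u > 0"
    and up: "\<And>i \<epsilon>. \<epsilon> > 0 \<Longrightarrow> \<P>(\<omega> in M. X \<omega> $ i \<ge> \<epsilon>) \<le> exp (- \<epsilon>\<^sup>2 / u)"
    and lo: "\<And>i \<epsilon>. \<epsilon> > 0 \<Longrightarrow> \<P>(\<omega> in M. - (X \<omega> $ i) \<ge> \<epsilon>) \<le> exp (- \<epsilon>\<^sup>2 / u)"
  shows "\<P>(\<omega> in M. (norm (X \<omega>))\<^sup>2 \<ge> A) \<le> 2 * real CARD('n) * exp (- A / (real CARD('n) * u))"
proof -
  define n where "n = real CARD('n)"
  have n: "n > 0" by (simp add: n_def)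
  define d where "d = sqrt (A / n)"
  have d: "d > 0" "d\<^sup>2 = A / n" using A n by (auto simp: d_def)
  have [measurable]: "X \<in> borel_measurable M" by (rule X)
  have [measurable]: "(\<lambda>\<omega>. X \<omega> $ i) \<in> borel_measurable M" for i
    using borel_measurable_continuous_on[OF _ X, of "\<lambda>v. v $ i"] by (simp add: continuous_on_component)
  let ?E = "\<lambda>i. {\<omega> \<in> space M. X \<omega> $ i \<ge> d} \<union> {\<omega> \<in> space M. - (X \<omega> $ i) \<ge> d}"
  have "{\<omega> \<in> space M. (norm (X \<omega>))\<^sup>2 \<ge> A} \<subseteq> (\<Union>i. ?E i)"
  proof (rule ccontr)
    assume "\<not> ?thesis"
    then obtain \<omega> where \<omega>: "(norm (X \<omega>))\<^sup>2 \<ge> A" "\<And>i. \<not> X \<omega> $ i \<ge> d" "\<And>i. \<not> - (X \<omega> $ i) \<ge> d"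
      by blast
    have bd: "\<bar>X \<omega> $ i\<bar> < \<bar>d\<bar>" for i using \<omega>(2)[of i] \<omega>(3)[of i] by linarith
    have "(norm (X \<omega>))\<^sup>2 = (\<Sum>i\<in>UNIV. (X \<omega> $ i)\<^sup>2)"
      by (simp add: norm_vec_def L2_set_def sum_nonneg)
    also have "\<dots> < (\<Sum>i\<in>(UNIV::'n set). d\<^sup>2)"
      using power_strict_mono[OF bd, of _ 2] by (intro sum_strict_mono) auto
    also have "\<dots> = A" using d n by (simp add: n_def)
    finally show False using \<omega>(1) by simp
  qed
  then have "\<P>(\<omega> in M. (norm (X \<omega>))\<^sup>2 \<ge> A) \<le> prob (\<Union>i. ?E i)"
    by (intro finite_measure_mono) auto
  also have "\<dots> \<le> (\<Sum>i\<in>UNIV. prob (?E i))"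
    by (intro finite_measure_subadditive_finite) auto
  also have "\<dots> \<le> (\<Sum>i\<in>(UNIV::'n set). 2 * exp (- d\<^sup>2 / u))"
  proof (intro sum_mono)
    fix i
    have "prob (?E i) \<le> \<P>(\<omega> in M. X \<omega> $ i \<ge> d) + \<P>(\<omega> in M. - (X \<omega> $ i) \<ge> d)"
      by (intro measure_Un_le) auto
    also have "\<dots> \<le> 2 * exp (- d\<^sup>2 / u)" using up[OF d(1), of i] lo[OF d(1), of i] by linarith
    finally show "prob (?E i) \<le> 2 * exp (- d\<^sup>2 / u)" .
  qed
  also have "\<dots> = 2 * n * exp (- A / (n * u))" using d by (simp add: n_def)
  finally show ?thesis by (simp add: n_def)
qed

end

section \<open>The exponential tail of the optimality gap\<close>

theorem theorem5p3:
  fixes f :: "real ^ 'n \<Rightarrow> real"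
    and gradf :: "real ^ 'n \<Rightarrow> real ^ 'n"
    and g h :: "real ^ 'n \<Rightarrow> ereal"
    and S :: "(real ^ 'n) set"
    and L \<tau> \<rho> \<beta> lam :: real
    and M :: "'w measure"
    and e x :: "nat \<Rightarrow> 'w \<Rightarrow> real ^ 'n"
    and x0 :: "real ^ 'n"
    and U :: "nat \<Rightarrow> real"
    and gap :: "nat \<Rightarrow> 'w \<Rightarrow> ereal"
  assumes grad: "\<And>y. GDERIV f y :> gradf y"
    and g_proper: "\<And>y. g y \<noteq> -\<infinity>"
    and g_convex: "ereal_convex g"
    and g_lsc: "lower_semicont g"
    and h_def: "h = (\<lambda>y. ereal (f y) + g y)"
    and S_def: "S = argmin_set h"
    and S_nonempty: "S \<noteq> {}"
    and L_pos: "L > 0"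
    and tau_ge: "\<tau> \<ge> 1"
    and lipschitz: "\<And>y z. norm (gradf z - gradf y) \<le> L * norm (z - y)"
    and error_bound: "\<And>y. infdist y S \<le> \<tau> * norm (y - prox g (1 / L) (y - (1 / L) *\<^sub>R gradf y))"
    and rho_def: "\<rho> = 40 * \<tau>\<^sup>2 / (1 + 40 * \<tau>\<^sup>2)"
    and M_prob: "prob_space M"
    and e_measurable: "\<And>k. e k \<in> borel_measurable M"
    and x0_dom: "g x0 \<noteq> \<infinity>"
    and x_0: "\<And>\<omega>. \<omega> \<in> space M \<Longrightarrow> x 0 \<omega> = x0"
    and x_Suc: "\<And>k \<omega>. \<omega> \<in> space M \<Longrightarrow>
      x (Suc k) \<omega> = prox g (1 / L) (x k \<omega> - (1 / L) *\<^sub>R (gradf (x k \<omega>) + e k \<omega>))"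
    and gap_def: "gap = (\<lambda>k \<omega>. h (x k \<omega>) - (INF y. h y))"
    and beta: "0 < \<beta>" "\<beta> < 1"
    and lam_pos: "lam > 0"
    and U_pos: "\<And>k. U k > 0"
    and U_le: "\<And>k. U k \<le> lam * \<beta> ^ k"
    and upper_tail: "\<And>k i \<epsilon>. \<epsilon> > 0 \<Longrightarrow>
      AE \<omega> in M. cond_pr M (past_algebra M e k) (\<lambda>\<omega>'. e k \<omega>' $ i \<ge> \<epsilon>) \<omega> \<le> exp (- \<epsilon>\<^sup>2 / U k)"
    and lower_tail: "\<And>k i \<epsilon>. \<epsilon> > 0 \<Longrightarrow>
      AE \<omega> in M. cond_pr M (past_algebra M e k) (\<lambda>\<omega>'. - (e k \<omega>' $ i) \<ge> \<epsilon>) \<omega> \<le> exp (- \<epsilon>\<^sup>2 / U k)"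
  shows "\<exists>\<zeta>>0. (\<lambda>(k, \<epsilon>). \<P>(\<omega> in M. gap k \<omega> - ereal (\<rho> ^ k) * gap 0 \<omega> \<ge> ereal \<epsilon>))
           \<in> O[top](\<lambda>(k, \<epsilon>). exp (- (\<epsilon> / (max \<beta> \<rho>) ^ k) * \<zeta>))"
proof -
  interpret prob_space M by (rule M_prob)
  interpret proper_convex_lsc g x0
    by unfold_locales (use g_proper g_convex g_lsc x0_dom in auto)
  obtain s0 where "s0 \<in> S" using S_nonempty by auto
  have S_min: "h s \<le> h y" if "s \<in> S" for s y
    using that by (auto simp: S_def argmin_set_def is_arg_min_def not_less)
  have S_dom: "g s \<noteq> \<infinity>" if "s \<in> S" for s
    using S_min[OF that, of x0] x0_dom g_eq[OF x0_dom] by (auto simp: h_def)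
  define H where "H = (\<lambda>y. f y + G y)"
  have h_eq: "h y = ereal (H y)" if "g y \<noteq> \<infinity>" for y
    using g_eq[OF that] by (simp add: h_def H_def)
  define m where "m = H s0"
  have inf_h: "(INF y. h y) = ereal m"
    using S_min[OF \<open>s0 \<in> S\<close>] h_eq[OF S_dom[OF \<open>s0 \<in> S\<close>]]
    by (intro antisym INF_lower2[of s0] INF_greatest) (simp_all add: m_def)
  have S_val: "f s + G s = m" if "s \<in> S" for s
    using S_min[OF that, of s0] S_min[OF \<open>s0 \<in> S\<close>, of s] h_eq[OF S_dom[OF that]]
      h_eq[OF S_dom[OF \<open>s0 \<in> S\<close>]]
    by (simp add: m_def H_def)
  interpret prox_gradient g x0 f gradf S L \<tau> m
    by unfold_locales (use grad lipschitz L_pos S_nonempty S_dom S_val error_bound in auto)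

  define n where "n = real CARD('n)"
  define \<mu> where "\<mu> = max \<beta> \<rho>"
  define q where "q = 8 * \<tau>\<^sup>2 / (1 + 8 * \<tau>\<^sup>2)"
  \<comment> \<open>The slack between the true contraction factor \<open>q\<close> and
    \<open>\<rho>\<close>; it supplies the decaying weights once \<open>\<mu>\<close> has been
    factored out.\<close>
  define r where "r = q / \<rho>"
  define c where "c = (10 * \<tau>\<^sup>2 + 1) / L"
  have \<tau>: "\<tau>\<^sup>2 > 0" using tau_ge by simp
  have n: "n > 0" by (simp add: n_def)
  have \<rho>: "\<rho> > 0" using \<tau> unfolding rho_def by (intro divide_pos_pos add_pos_pos mult_pos_pos) auto
  have \<mu>: "\<mu> > 0" using beta by (simp add: \<mu>_def)
  have q: "q > 0" using \<tau> unfolding q_def by (intro divide_pos_pos add_pos_pos mult_pos_pos) auto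
  have "1 + 8 * \<tau>\<^sup>2 > 0" "1 + 40 * \<tau>\<^sup>2 > 0" using \<tau> by linarith+
  then have "8 * \<tau>\<^sup>2 / (1 + 8 * \<tau>\<^sup>2) < 40 * \<tau>\<^sup>2 / (1 + 40 * \<tau>\<^sup>2)"
    using \<tau> by (simp only: pos_less_divide_eq pos_divide_less_eq times_divide_eq_left) (simp add: algebra_simps)
  then have "q < \<rho>" by (simp add: q_def rho_def)
  then have r: "0 < r" "r < 1" using q \<rho> by (simp_all add: r_def)
  have q_le: "q \<le> r * \<mu>"
  proof -
    have "q = r * \<rho>" using \<rho> by (simp add: r_def)
    also have "\<dots> \<le> r * \<mu>" using r by (intro mult_left_mono) (auto simp: \<mu>_def)
    finally show ?thesis .
  qed
  have c: "c > 0" using L_pos \<tau> by (simp add: c_def add_pos_nonneg)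

  define \<pi> where "\<pi> = (\<lambda>k \<omega>. H (x k \<omega>) - m)"
  have x_dom: "g (x k \<omega>) \<noteq> \<infinity>" if "\<omega> \<in> space M" for k \<omega>
    using that x_0 x_Suc x0_dom prox_dom L_pos by (cases k) auto
  have gap_eq: "gap k \<omega> = ereal (\<pi> k \<omega>)" if "\<omega> \<in> space M" for k \<omega>
    using h_eq[OF x_dom[OF that, of k]] inf_h by (simp add: gap_def \<pi>_def)
  have \<pi>0: "\<pi> 0 \<omega> \<ge> 0" if "\<omega> \<in> space M" for \<omega>
    using S_min[OF \<open>s0 \<in> S\<close>, of "x 0 \<omega>"] h_eq[OF x_dom[OF that, of 0]]
      h_eq[OF S_dom[OF \<open>s0 \<in> S\<close>]]
    by (simp add: \<pi>_def m_def)
  have gap_le: "\<pi> k \<omega> - \<rho> ^ k * \<pi> 0 \<omega> \<le> (\<Sum>i<k. q ^ (k - Suc i) * (c * (norm (e i \<omega>))\<^sup>2))"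
    if \<omega>: "\<omega> \<in> space M" for k \<omega>
  proof -
    have "\<pi> (Suc i) \<omega> \<le> q * \<pi> i \<omega> + c * (norm (e i \<omega>))\<^sup>2" for i
      using step_contraction[OF x_dom[OF \<omega>], of i "e i \<omega>"]
      by (simp add: \<pi>_def H_def q_def c_def x_Suc[OF \<omega>])
    then have "\<pi> k \<omega> \<le> q ^ k * \<pi> 0 \<omega> + (\<Sum>i<k. q ^ (k - Suc i) * (c * (norm (e i \<omega>))\<^sup>2))"
      using q by (intro linear_recursion_le) auto
    \<comment> \<open>Monotonicity in the base needs a nonnegative initial gap, hence the fact on
      \<open>\<pi> 0\<close>.\<close>
    moreover have "q ^ k * \<pi> 0 \<omega> \<le> \<rho> ^ k * \<pi> 0 \<omega>"
      using \<open>q < \<rho>\<close> q \<pi>0[OF \<omega>] by (intro mult_right_mono power_mono) auto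
    ultimately show ?thesis by simp
  qed

  have tail: "\<P>(\<omega> in M. (norm (e i \<omega>))\<^sup>2 \<ge> A) \<le> 2 * n * exp (- A / (n * (lam * \<mu> ^ i)))"
    if A: "A > 0" for i A
  proof -
    note sub = past_algebra_subalgebra[OF e_measurable, where k = i]
    have [measurable]: "e i \<in> borel_measurable M" by (rule e_measurable)
    have [measurable]: "(\<lambda>\<omega>. e i \<omega> $ j) \<in> borel_measurable M" for j
      using borel_measurable_continuous_on[OF _ e_measurable, of "\<lambda>v. v $ j"]
      by (simp add: continuous_on_component)
    have "\<P>(\<omega> in M. (norm (e i \<omega>))\<^sup>2 \<ge> A) \<le> 2 * real CARD('n) * exp (- A / (real CARD('n) * U i))"
      by (rule norm_square_tail[OF e_measurable A U_pos]; rule prob_le_of_cond_pr_le[OF sub])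
         (use upper_tail lower_tail in auto)
    also have "\<dots> \<le> 2 * n * exp (- A / (n * (lam * \<mu> ^ i)))"
    proof -
      have "\<beta> ^ i \<le> \<mu> ^ i" using beta by (intro power_mono) (auto simp: \<mu>_def)
      then have "U i \<le> lam * \<mu> ^ i" using U_le[of i] lam_pos
        by (meson mult_left_mono less_imp_le order_trans)
      then have "A / (n * (lam * \<mu> ^ i)) \<le> A / (n * U i)"
        using A n U_pos[of i] lam_pos \<mu> by (intro divide_left_mono mult_left_mono mult_pos_pos) auto
      then show ?thesis using n by (simp add: n_def)
    qed
    finally show ?thesis .
  qed

  \<comment> \<open>Chosen so that the thresholds \<open>A i\<close> below add up to exactly
    \<open>\<epsilon>\<close>; the factor \<open>\<mu>\<close> compensates for
    \<open>\<mu> ^ (k - 1)\<close> in place of \<open>\<mu> ^ k\<close>.\<close>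
  define \<zeta> where "\<zeta> = \<mu> * (1 - r)\<^sup>2 / (c * n * lam)"
  have \<zeta>: "\<zeta> > 0" using \<mu> r c n lam_pos by (simp add: \<zeta>_def)
  have main: "\<P>(\<omega> in M. gap k \<omega> - ereal (\<rho> ^ k) * gap 0 \<omega> \<ge> ereal \<epsilon>)
      \<le> (4 * n + 3) * exp (- (\<epsilon> / \<mu> ^ k) * \<zeta>)" for k \<epsilon>
  proof (cases "\<epsilon> / \<mu> ^ k * \<zeta> \<ge> 1")
    case False
    \<comment> \<open>When the scaled deviation is below 1, negative \<open>\<epsilon>\<close>
      included, the trivial bound 1 suffices: the summand 3 in the constant dominates
      \<open>exp 1\<close>.\<close>
    have "1 = exp (\<epsilon> / \<mu> ^ k * \<zeta>) * exp (- (\<epsilon> / \<mu> ^ k) * \<zeta>)" by (simp add: exp_minus)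
    also have "\<dots> \<le> exp 1 * exp (- (\<epsilon> / \<mu> ^ k) * \<zeta>)"
      using False by (intro mult_right_mono) auto
    also have "\<dots> \<le> (4 * n + 3) * exp (- (\<epsilon> / \<mu> ^ k) * \<zeta>)"
      using exp_le n by (intro mult_right_mono) auto
    finally show ?thesis using prob_le_1 order_trans by blast
  next
    case True
    define Q where "Q = \<epsilon> / \<mu> ^ k * \<zeta>"
    have Q: "Q \<ge> 1" using True Q_def by simp
    then have \<epsilon>: "\<epsilon> > 0" using \<mu> \<zeta> unfolding Q_def
      by (smt (verit) divide_nonpos_pos mult_nonpos_nonneg zero_less_power)
    \<comment> \<open>The factor \<open>\<mu> ^ i\<close> matches the scale of the tail of
      \<open>e i\<close>, so that its exponent becomes \<open>- Q * real (k - i)\<close>; the age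
      factor makes these bounds summable uniformly in \<open>k\<close>.\<close>
    define A where "A = (\<lambda>i. Q * n * lam * \<mu> ^ i * real (k - i))"
    have A_pos: "A i > 0" if "i < k" for i using that Q n lam_pos \<mu> by (simp add: A_def)
    have sub: "{\<omega> \<in> space M. gap k \<omega> - ereal (\<rho> ^ k) * gap 0 \<omega> \<ge> ereal \<epsilon>}
        \<subseteq> (\<Union>i<k. {\<omega> \<in> space M. (norm (e i \<omega>))\<^sup>2 \<ge> A i})"
    proof (rule ccontr)
      assume "\<not> ?thesis"
      then obtain \<omega> where \<omega>: "\<omega> \<in> space M" "gap k \<omega> - ereal (\<rho> ^ k) * gap 0 \<omega> \<ge> ereal \<epsilon>"
        and small: "\<And>i. i < k \<Longrightarrow> (norm (e i \<omega>))\<^sup>2 < A i" by force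
      have "\<epsilon> \<le> (\<Sum>i<k. q ^ (k - Suc i) * (c * (norm (e i \<omega>))\<^sup>2))"
        using \<omega>(2) gap_le[OF \<omega>(1), of k] gap_eq[OF \<omega>(1)] by simp
      also have "\<dots> \<le> (\<Sum>i<k. r ^ (k - Suc i) * (\<mu> ^ (k - Suc i) * (c * (norm (e i \<omega>))\<^sup>2)))"
      proof (intro sum_mono)
        fix i
        have "q ^ (k - Suc i) \<le> (r * \<mu>) ^ (k - Suc i)" using q_le q by (intro power_mono) auto
        then show "q ^ (k - Suc i) * (c * (norm (e i \<omega>))\<^sup>2)
            \<le> r ^ (k - Suc i) * (\<mu> ^ (k - Suc i) * (c * (norm (e i \<omega>))\<^sup>2))"
          using c unfolding power_mult_distrib mult.assoc[symmetric]
          by (intro mult_right_mono) auto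
      qed
      finally have le: "\<epsilon> \<le> \<dots>" .
      \<comment> \<open>For \<open>k = 0\<close> the sum is empty and cannot reach the positive
        \<open>\<epsilon>\<close>.\<close>
      then have k: "k > 0" using \<epsilon> by (cases k) auto
      define B where "B = c * Q * n * lam * \<mu> ^ (k - 1)"
      have "(\<Sum>i<k. r ^ (k - Suc i) * (\<mu> ^ (k - Suc i) * (c * (norm (e i \<omega>))\<^sup>2))) < B / (1 - r)\<^sup>2"
      proof (rule weighted_geometric_sum_less)
        fix i assume i: "i < k"
        have "\<mu> ^ (k - Suc i) * (c * (norm (e i \<omega>))\<^sup>2) < \<mu> ^ (k - Suc i) * (c * A i)"
          using small[OF i] c \<mu> by simp
        also have "\<dots> = c * Q * n * lam * (\<mu> ^ (k - Suc i) * \<mu> ^ i) * real (k - i)"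
          by (simp add: A_def)
        \<comment> \<open>The decay of the threshold and the weight of the error combine to a power
          independent of \<open>i\<close>, leaving only linear growth in the age.\<close>
        also have "\<mu> ^ (k - Suc i) * \<mu> ^ i = \<mu> ^ (k - 1)"
          using i by (simp add: power_add[symmetric])
        finally show "\<mu> ^ (k - Suc i) * (c * (norm (e i \<omega>))\<^sup>2) < B * real (k - i)"
          by (simp add: B_def)
      qed (use r k c Q n lam_pos \<mu> in \<open>auto simp: B_def\<close>)
      also have "B / (1 - r)\<^sup>2 = \<epsilon>"
      proof -
        have "\<mu> ^ k = \<mu> * \<mu> ^ (k - 1)" using k by (simp add: power_eq_if)
        then show ?thesis
          using c n lam_pos \<mu> r by (simp add: B_def Q_def \<zeta>_def)
      qed
      finally show False using le by simp
    qed
    have [measurable]: "e i \<in> borel_measurable M" for i by (rule e_measurable)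
    have "\<P>(\<omega> in M. gap k \<omega> - ereal (\<rho> ^ k) * gap 0 \<omega> \<ge> ereal \<epsilon>)
        \<le> prob (\<Union>i<k. {\<omega> \<in> space M. (norm (e i \<omega>))\<^sup>2 \<ge> A i})"
      using sub by (rule finite_measure_mono) measurable
    also have "\<dots> \<le> (\<Sum>i<k. \<P>(\<omega> in M. (norm (e i \<omega>))\<^sup>2 \<ge> A i))"
      by (rule finite_measure_subadditive_finite) auto
    also have "\<dots> \<le> (\<Sum>i<k. 2 * n * exp (- Q * real (k - i)))"
    proof (intro sum_mono)
      fix i assume i: "i \<in> {..<k}"
      have "- A i / (n * (lam * \<mu> ^ i)) = - Q * real (k - i)"
        using n lam_pos \<mu> by (simp add: A_def)
      then show "\<P>(\<omega> in M. (norm (e i \<omega>))\<^sup>2 \<ge> A i) \<le> 2 * n * exp (- Q * real (k - i))"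
        using tail[OF A_pos, of i i] i by simp
    qed
    also have "\<dots> = 2 * n * (\<Sum>i<k. exp (- Q * real (k - i)))" by (simp add: sum_distrib_left)
    also have "\<dots> \<le> 2 * n * (2 * exp (- Q))"
      using n by (intro mult_left_mono exp_tail_sum_le Q) auto
    also have "\<dots> \<le> (4 * n + 3) * exp (- (\<epsilon> / \<mu> ^ k) * \<zeta>)" by (simp add: Q_def algebra_simps)
    finally show ?thesis .
  qed
  show ?thesis
  \<comment> \<open>For the filter \<open>top\<close> the bound must hold at every pair
    \<open>(k, \<epsilon>)\<close>; \<open>main\<close> gives this with one constant depending only
    on the dimension.\<close>
  proof (intro exI[of _ \<zeta>] conjI \<zeta> bigoI[where c = "4 * n + 3"])
    show "\<forall>\<^sub>F p in top. norm (case p of (k, \<epsilon>) \<Rightarrow>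
          \<P>(\<omega> in M. gap k \<omega> - ereal (\<rho> ^ k) * gap 0 \<omega> \<ge> ereal \<epsilon>))
        \<le> (4 * n + 3) * norm (case p of (k, \<epsilon>) \<Rightarrow> exp (- (\<epsilon> / (max \<beta> \<rho>) ^ k) * \<zeta>))"
      using main by (auto simp: eventually_top \<mu>_def)
  qed
qed

end
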